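(* Let $\mathcal{H}$ be the integer Heisenberg group, i.e. the group of upper triangular $3\times 3$ integer matrices with all diagonal entries equal to $1$. There exists an uncountable collection of minimal equicontinuous Cantor actions $(\mathfrak{X},\mathcal{H},\Phi)$, no two distinct members of which are return equivalent, such that each action in the collection is topologically free and wild.
   Context: A Cantor action $(\mathfrak{X}, \Gamma, \Phi)$ consists of a countable group $\Gamma$, a Cantor space $\mathfrak{X}$ and a minimal action $\Phi \colon \Gamma \times \mathfrak{X} \to \mathfrak{X}$ by homeomorphisms (every orbit is dense). It is equicontinuous if, for a metric $d_{\mathfrak{X}}$ compatible with the topology, for all $\varepsilon>0$ there is $\delta>0$ such that $d_{\mathfrak{X}}(x,y)<\delta$ implies $d_{\mathfrak{X}}(\gamma x,\gamma y)<\varepsilon$ for all $\gamma\in\Gamma$. For such an action, $\mathfrak{G}(\Phi) = \overline{\Phi(\Gamma)} \subset \mathrm{Homeo}(\mathfrak{X})$ denotes the closure in the uniform topology, a profinite group acting on $\mathfrak{X}$; this action is denoted $\widehat\Phi$. The action is topologically free if the set $\{x\in\mathfrak{X}\mid \exists\, g\in\Gamma,\ g\neq e,\ g\cdot x=x\}$ is meager in $\mathfrak{X}$. An action $\Psi\colon H\times\mathfrak{X}\to\mathfrak{X}$ of a topological group $H$ on a Cantor metric space $(\mathfrak{X},d_{\mathfrak{X}})$ is locally quasi-analytic if there exists $\varepsilon>0$ such that for any non-empty open set $U\subset\mathfrak{X}$ with $\mathrm{diam}(U)<\varepsilon$ and any non-empty open subset $V\subset U$: if $g\in H$ satisfies $\Psi(g)(V)=V$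 and $\Psi(g)|V$ is the identity map on $V$, then $\Psi(g)$ acts as the identity on all of $U$. An equicontinuous Cantor action is stable if $\widehat\Phi\colon\mathfrak{G}(\Phi)\times\mathfrak{X}\to\mathfrak{X}$ is locally quasi-analytic, and wild otherwise. A non-empty clopen set $U \subset \mathfrak{X}$ is adapted to the action if for every $g\in\Gamma$, $\Phi(g)(U)\cap U\neq\emptyset$ implies $\Phi(g)(U)=U$. Then $\Gamma_U = \{g\in\Gamma\mid \Phi(g)(U)\cap U \ne\emptyset\}$ is a subgroup of finite index; let $H_U\subset \mathrm{Homeo}(U)$ be the image of $\Gamma_U$ under restriction of the action to $U$, and let $(U,H_U,\Phi_U)$ be the resulting action. Actions $(\mathfrak{Y}_1,H_1,\Psi_1)$, $(\mathfrak{Y}_2,H_2,\Psi_2)$ are isomorphic if there are a homeomorphism $h\colon \mathfrak{Y}_1\to\mathfrak{Y}_2$ and a group isomorphism $\Theta\colon H_1\to H_2$ with $\Psi_1(g) = h^{-1}\circ\Psi_2(\Theta(g))\circ h$ for all $g\in H_1$. Two minimal equicontinuous Cantor actions $(\mathfrak{X}_i,\Gamma_i,\Phi_i)$, $i=1,2$, are return equivalent if there are adapted sets $U_i\subset\mathfrak{X}_i$ for $\Phi_i$ such that $(U_1,H_{1,U_1},\Phi_{1,U_1})$ and $(U_2,H_{2,U_2},\Phi_{2,U_2})$ are isomorphic. *)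

theory Defs
  imports "HOL-Analysis.Analysis" "HOL-Algebra.Group_Action"
begin

definition cantor_space :: "'x topology \<Rightarrow> bool" where
  "cantor_space X \<longleftrightarrow>
     topspace X \<noteq> {} \<and> compact_space X \<and> metrizable_space X \<and>
     (\<forall>x \<in> topspace X. connected_component_of_set X x = {x}) \<and>
     X derived_set_of topspace X = topspace X"

text \<open>An action of \<open>G\<close> on \<open>X\<close> is a homomorphism \<open>\<phi>\<close> into the group
  \<^const>\<open>BijGroup\<close> of bijections of \<open>topspace X\<close>; these are extensional functions, so each
  \<open>\<phi> g\<close> is determined by its values on \<open>topspace X\<close>.\<close>

definition cantor_action ::
    "'x topology \<Rightarrow> ('g, 'r) monoid_scheme \<Rightarrow> ('g \<Rightarrow> 'x \<Rightarrow> 'x) \<Rightarrow> bool" where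
  "cantor_action X G \<phi> \<longleftrightarrow>
     cantor_space X \<and> countable (carrier G) \<and>
     group_action G (topspace X) \<phi> \<and>
     (\<forall>g \<in> carrier G. homeomorphic_map X X (\<phi> g)) \<and>
     (\<forall>x \<in> topspace X. X closure_of (orbit G \<phi> x) = topspace X)"

definition equicontinuous_action ::
    "'x topology \<Rightarrow> ('g, 'r) monoid_scheme \<Rightarrow> ('g \<Rightarrow> 'x \<Rightarrow> 'x) \<Rightarrow> bool" where
  "equicontinuous_action X G \<phi> \<longleftrightarrow>
     (\<exists>m. mtopology_of m = X \<and>
        (\<forall>\<epsilon>>0. \<exists>\<delta>>0. \<forall>x \<in> topspace X. \<forall>y \<in> topspace X.
           mdist m x y < \<delta> \<longrightarrow>
           (\<forall>g \<in> carrier G. mdist m (\<phi> g x) (\<phi> g y) < \<epsilon>)))"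

definition meager_in :: "'x topology \<Rightarrow> 'x set \<Rightarrow> bool" where
  "meager_in X S \<longleftrightarrow>
     (\<exists>\<A>. countable \<A> \<and> S = \<Union>\<A> \<and>
        (\<forall>A \<in> \<A>. A \<subseteq> topspace X \<and> X interior_of (X closure_of A) = {}))"

definition topologically_free ::
    "'x topology \<Rightarrow> ('g, 'r) monoid_scheme \<Rightarrow> ('g \<Rightarrow> 'x \<Rightarrow> 'x) \<Rightarrow> bool" where
  "topologically_free X G \<phi> \<longleftrightarrow>
     meager_in X {x \<in> topspace X. \<exists>g \<in> carrier G. g \<noteq> \<one>\<^bsub>G\<^esub> \<and> \<phi> g x = x}"

definition homeo_set :: "'x topology \<Rightarrow> ('x \<Rightarrow> 'x) set" where
  "homeo_set X = {f \<in> extensional (topspace X). homeomorphic_map X X f}"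

text \<open>\<^const>\<open>cfunspace\<close> is the space of continuous maps with the supremum metric.\<close>

definition uniform_topology :: "'x metric \<Rightarrow> ('x \<Rightarrow> 'x) topology" where
  "uniform_topology m =
     subtopology (mtopology_of (cfunspace (mtopology_of m) m)) (homeo_set (mtopology_of m))"

definition closure_group ::
    "'x metric \<Rightarrow> ('g, 'r) monoid_scheme \<Rightarrow> ('g \<Rightarrow> 'x \<Rightarrow> 'x) \<Rightarrow> ('x \<Rightarrow> 'x) monoid" where
  "closure_group m G \<phi> =
     (BijGroup (mspace m)) \<lparr>carrier := uniform_topology m closure_of (\<phi> ` carrier G)\<rparr>"

definition mdiameter :: "'x metric \<Rightarrow> 'x set \<Rightarrow> real" where
  "mdiameter m S = (if S = {} then 0 else SUP (x, y) \<in> S \<times> S. mdist m x y)"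

definition locally_quasi_analytic ::
    "'x metric \<Rightarrow> ('h, 'r) monoid_scheme \<Rightarrow> ('h \<Rightarrow> 'x \<Rightarrow> 'x) \<Rightarrow> bool" where
  "locally_quasi_analytic m H \<Psi> \<longleftrightarrow>
     (\<exists>\<epsilon>>0. \<forall>U V.
        openin (mtopology_of m) U \<and> U \<noteq> {} \<and> mdiameter m U < \<epsilon> \<and>
        openin (mtopology_of m) V \<and> V \<noteq> {} \<and> V \<subseteq> U \<longrightarrow>
        (\<forall>g \<in> carrier H. \<Psi> g ` V = V \<and> (\<forall>x \<in> V. \<Psi> g x = x) \<longrightarrow> (\<forall>x \<in> U. \<Psi> g x = x)))"

text \<open>The closure group consists of maps and acts by evaluation, hence the identity as its
  action.  On a compact space neither the closure group nor local quasi-analyticity depends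
  on the compatible metric.\<close>

definition stable_action ::
    "'x topology \<Rightarrow> ('g, 'r) monoid_scheme \<Rightarrow> ('g \<Rightarrow> 'x \<Rightarrow> 'x) \<Rightarrow> bool" where
  "stable_action X G \<phi> \<longleftrightarrow>
     (\<exists>m. mtopology_of m = X \<and>
        locally_quasi_analytic m (closure_group m G \<phi>) (\<lambda>f. f))"

definition wild_action ::
    "'x topology \<Rightarrow> ('g, 'r) monoid_scheme \<Rightarrow> ('g \<Rightarrow> 'x \<Rightarrow> 'x) \<Rightarrow> bool" where
  "wild_action X G \<phi> \<longleftrightarrow> \<not> stable_action X G \<phi>"

definition adapted ::
    "'x topology \<Rightarrow> ('g, 'r) monoid_scheme \<Rightarrow> ('g \<Rightarrow> 'x \<Rightarrow> 'x) \<Rightarrow> 'x set \<Rightarrow> bool" where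
  "adapted X G \<phi> U \<longleftrightarrow>
     U \<noteq> {} \<and> openin X U \<and> closedin X U \<and>
     (\<forall>g \<in> carrier G. \<phi> g ` U \<inter> U \<noteq> {} \<longrightarrow> \<phi> g ` U = U)"

definition return_set ::
    "('g, 'r) monoid_scheme \<Rightarrow> ('g \<Rightarrow> 'x \<Rightarrow> 'x) \<Rightarrow> 'x set \<Rightarrow> 'g set" where
  "return_set G \<phi> U = {g \<in> carrier G. \<phi> g ` U \<inter> U \<noteq> {}}"

definition holonomy_group ::
    "('g, 'r) monoid_scheme \<Rightarrow> ('g \<Rightarrow> 'x \<Rightarrow> 'x) \<Rightarrow> 'x set \<Rightarrow> ('x \<Rightarrow> 'x) monoid" where
  "holonomy_group G \<phi> U =
     (BijGroup U) \<lparr>carrier := (\<lambda>g. restrict (\<phi> g) U) ` return_set G \<phi> U\<rparr>"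

definition isomorphic_actions ::
    "'x topology \<Rightarrow> ('g, 'r) monoid_scheme \<Rightarrow> ('g \<Rightarrow> 'x \<Rightarrow> 'x) \<Rightarrow>
     'y topology \<Rightarrow> ('h, 's) monoid_scheme \<Rightarrow> ('h \<Rightarrow> 'y \<Rightarrow> 'y) \<Rightarrow> bool" where
  "isomorphic_actions Y1 H1 \<Psi>1 Y2 H2 \<Psi>2 \<longleftrightarrow>
     (\<exists>h h' \<Theta>. homeomorphic_maps Y1 Y2 h h' \<and> \<Theta> \<in> iso H1 H2 \<and>
        (\<forall>g \<in> carrier H1. \<forall>y \<in> topspace Y1. \<Psi>1 g y = h' (\<Psi>2 (\<Theta> g) (h y))))"

definition return_equivalent ::
    "'x topology \<Rightarrow> ('g, 'r) monoid_scheme \<Rightarrow> ('g \<Rightarrow> 'x \<Rightarrow> 'x) \<Rightarrow>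
     'y topology \<Rightarrow> ('h, 's) monoid_scheme \<Rightarrow> ('h \<Rightarrow> 'y \<Rightarrow> 'y) \<Rightarrow> bool" where
  "return_equivalent X1 G1 \<phi>1 X2 G2 \<phi>2 \<longleftrightarrow>
     (\<exists>U1 U2. adapted X1 G1 \<phi>1 U1 \<and> adapted X2 G2 \<phi>2 U2 \<and>
        isomorphic_actions
          (subtopology X1 U1) (holonomy_group G1 \<phi>1 U1) (\<lambda>f. f)
          (subtopology X2 U2) (holonomy_group G2 \<phi>2 U2) (\<lambda>f. f))"

definition heisenberg_group :: "(int ^ 3 ^ 3) monoid" where
  "heisenberg_group =
     \<lparr>carrier = {A. (\<forall>i. A $ i $ i = 1) \<and> A $ 2 $ 1 = 0 \<and> A $ 3 $ 1 = 0 \<and> A $ 3 $ 2 = 0},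
      mult = (**), one = mat 1\<rparr>"

end

(* Let q enumerate distinct primes and let the Heisenberg group act on the product of the planes
   (Z/q_i)^2, the matrix with entries a, b, c acting on the i-th plane by
   (z, y) |-> (z + a y + c, y + b).  By the Chinese remainder theorem the action is minimal, and its
   closure contains every sequence (a_i, b_i, c_i) of such maps; the shear supported on one
   plane makes it wild.  A non-trivial integer matrix, however, moves points in almost
   all planes, so its fixed point set is nowhere dense.

   For an adapted set U, a prime p = q_i with i large divides all return times of a central
   element to some open subset of U, whereas for an odd prime outside the range of q no element and
   open set have this property.  Hence return equivalence determines the set of primes up to finitely many,
   and an uncountable almost disjoint family of sets of primes gives the required actions. *)

theory Submission
  imports Defs "HOL-Number_Theory.Cong" "HOL-Library.Nat_Bijection"
begin

section \<open>Affine maps of a product of planes over prime fields\<close>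

definition tower_space :: "(nat \<Rightarrow> nat) \<Rightarrow> (nat \<Rightarrow> nat) topology" where
  "tower_space q = product_topology (\<lambda>j. discrete_topology {..<q (j div 2)}) UNIV"

text \<open>Coordinates \<open>2 * i\<close> and \<open>2 * i + 1\<close> are the components \<open>z\<close> and \<open>y\<close> of a point in the
  \<open>i\<close>-th plane over the field with \<open>q i\<close> elements; a cylinder of level \<open>n\<close> prescribes whole planes,
  and thus its images under the maps below are contained in cylinders of the same level.\<close>

definition cylinder :: "(nat \<Rightarrow> nat) \<Rightarrow> nat \<Rightarrow> (nat \<Rightarrow> nat) \<Rightarrow> (nat \<Rightarrow> nat) set" where
  "cylinder q n x = {y \<in> topspace (tower_space q). \<forall>j<2 * n. y j = x j}"

text \<open>The parameters are sequences, one triple per plane: constant sequences give the integer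
  matrices, arbitrary ones give elements of the closure group. The restriction makes the maps
  extensional, as \<open>BijGroup\<close> and \<open>homeo_set\<close> require.\<close>

definition tower_map ::
    "(nat \<Rightarrow> nat) \<Rightarrow> (nat \<Rightarrow> int) \<Rightarrow> (nat \<Rightarrow> int) \<Rightarrow> (nat \<Rightarrow> int) \<Rightarrow> (nat \<Rightarrow> nat) \<Rightarrow> nat \<Rightarrow> nat" where
  "tower_map q a b c = (\<lambda>x \<in> topspace (tower_space q). \<lambda>j.
     nat ((if even j then int (x j) + a (j div 2) * int (x (Suc j)) + c (j div 2)
           else int (x j) + b (j div 2)) mod int (q (j div 2))))"

definition heis_act :: "(nat \<Rightarrow> nat) \<Rightarrow> int ^ 3 ^ 3 \<Rightarrow> (nat \<Rightarrow> nat) \<Rightarrow> nat \<Rightarrow> nat" where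
  "heis_act q A = tower_map q (\<lambda>_. A $ 1 $ 2) (\<lambda>_. A $ 2 $ 3) (\<lambda>_. A $ 1 $ 3)"

section \<open>The integer Heisenberg group in coordinates\<close>

definition heis :: "int \<Rightarrow> int \<Rightarrow> int \<Rightarrow> int ^ 3 ^ 3" where
  "heis a b c = vector [vector [1, a, c], vector [0, 1, b], vector [0, 0, 1]]"

lemma heis_nth [simp]: "heis a b c $ 1 $ 2 = a" "heis a b c $ 2 $ 3 = b" "heis a b c $ 1 $ 3 = c"
  by (simp_all add: heis_def)

lemma heis_carrier [simp]: "heis a b c \<in> carrier heisenberg_group"
  by (simp add: heis_def heisenberg_group_def forall_3)

lemma carrier_heisenberg_groupE:
  assumes "A \<in> carrier heisenberg_group"
  obtains a b c where "A = heis a b c"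
proof
  show "A = heis (A $ 1 $ 2) (A $ 2 $ 3) (A $ 1 $ 3)"
    using assms by (simp add: heisenberg_group_def heis_def vec_eq_iff forall_3)
qed

lemma heis_mult [simp]:
  "heis a b c \<otimes>\<^bsub>heisenberg_group\<^esub> heis a' b' c' = heis (a + a') (b + b') (c + c' + a * b')"
  by (simp add: heisenberg_group_def heis_def matrix_matrix_mult_def vec_eq_iff forall_3 sum_3)

lemma heis_one: "\<one>\<^bsub>heisenberg_group\<^esub> = heis 0 0 0"
  by (simp add: heisenberg_group_def heis_def mat_def vec_eq_iff forall_3)

lemma group_heisenberg_group: "group heisenberg_group"
proof (rule groupI)
  fix A B C
  assume "A \<in> carrier heisenberg_group" "B \<in> carrier heisenberg_group" "C \<in> carrier heisenberg_group"
  then obtain a b c a' b' c' a'' b'' c''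
    where eq: "A = heis a b c" "B = heis a' b' c'" "C = heis a'' b'' c''"
    by (metis carrier_heisenberg_groupE)
  show "A \<otimes>\<^bsub>heisenberg_group\<^esub> B \<in> carrier heisenberg_group"
    by (simp add: eq)
  show "A \<otimes>\<^bsub>heisenberg_group\<^esub> B \<otimes>\<^bsub>heisenberg_group\<^esub> C =
      A \<otimes>\<^bsub>heisenberg_group\<^esub> (B \<otimes>\<^bsub>heisenberg_group\<^esub> C)"
    by (simp add: eq algebra_simps)
next
  fix A assume "A \<in> carrier heisenberg_group"
  then obtain a b c where A: "A = heis a b c"
    by (rule carrier_heisenberg_groupE)
  have "heis (- a) (- b) (a * b - c) \<otimes>\<^bsub>heisenberg_group\<^esub> A = \<one>\<^bsub>heisenberg_group\<^esub>"
    by (simp add: A heis_one)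
  then show "\<exists>B \<in> carrier heisenberg_group. B \<otimes>\<^bsub>heisenberg_group\<^esub> A = \<one>\<^bsub>heisenberg_group\<^esub>"
    using heis_carrier by blast
  show "\<one>\<^bsub>heisenberg_group\<^esub> \<otimes>\<^bsub>heisenberg_group\<^esub> A = A"
    by (simp add: A heis_one)
qed (simp add: heis_one)

lemma countable_heisenberg_group: "countable (carrier heisenberg_group)"
proof (rule countable_subset)
  show "carrier heisenberg_group \<subseteq> range (\<lambda>(a, b, c). heis a b c)"
  proof
    fix A assume "A \<in> carrier heisenberg_group"
    then obtain a b c where "A = heis a b c"
      by (rule carrier_heisenberg_groupE)
    then show "A \<in> range (\<lambda>(a, b, c). heis a b c)"
      by (intro image_eqI[of _ _ "(a, b, c)"]) simp_all
  qed
qed simp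

lemma heis_act_heis: "heis_act q (heis a b c) = tower_map q (\<lambda>_. a) (\<lambda>_. b) (\<lambda>_. c)"
  by (simp add: heis_act_def)

section \<open>Cylinders, the product topology and its compatible metrics\<close>

lemma topspace_tower_space: "topspace (tower_space q) = {x. \<forall>j. x j < q (j div 2)}"
  by (auto simp: tower_space_def PiE_def Pi_def)

lemma cylinder_refl: "x \<in> topspace (tower_space q) \<Longrightarrow> x \<in> cylinder q n x"
  by (simp add: cylinder_def)

lemma cylinder_mono: "n \<le> m \<Longrightarrow> cylinder q m x \<subseteq> cylinder q n x"
  by (auto simp: cylinder_def)

lemma cylinder_subset: "cylinder q n x \<subseteq> topspace (tower_space q)"
  by (auto simp: cylinder_def)

lemma cylinder_eq: "y \<in> cylinder q n x \<Longrightarrow> cylinder q n y = cylinder q n x"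
  by (auto simp: cylinder_def)

lemma openin_cylinder: "openin (tower_space q) (cylinder q n x)"
proof -
  let ?T = "\<lambda>j. {..<q (j div 2)}"
  let ?S = "\<lambda>j. if j < 2 * n then ?T j \<inter> {x j} else ?T j"
  have "finite {j. ?S j \<noteq> ?T j}"
    by (rule finite_subset[of _ "{..<2 * n}"]) (auto split: if_splits)
  then have "openin (tower_space q) (PiE UNIV ?S)"
    unfolding tower_space_def by (auto simp: openin_PiE_gen)
  moreover have "PiE UNIV ?S = cylinder q n x"
    by (force simp: cylinder_def topspace_tower_space PiE_def Pi_def split: if_splits)
  ultimately show ?thesis by simp
qed

lemma openin_tower_space_imp_cylinder:
  assumes "openin (tower_space q) U" "x \<in> U"
  shows "\<exists>n. cylinder q n x \<subseteq> U"
proof -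
  let ?T = "\<lambda>j. {..<q (j div 2)}"
  obtain V where fin: "finite {j. V j \<noteq> ?T j}" and x: "x \<in> PiE UNIV V" and V: "PiE UNIV V \<subseteq> U"
    using assms unfolding tower_space_def openin_product_topology_alt by fastforce
  \<comment> \<open>All restricted coordinates lie below \<open>n\<close>, hence among the
    \<open>2 * n\<close> coordinates that a cylinder of level \<open>n\<close> prescribes.\<close>
  obtain n where n: "{j. V j \<noteq> ?T j} \<subseteq> {..<n}"
    using fin finite_nat_iff_bounded by blast
  have "y \<in> U" if y: "y \<in> cylinder q n x" for y
  proof -
    have "y j \<in> V j" for j
    proof (cases "j < 2 * n")
      case True
      then show ?thesis using y x by (auto simp: cylinder_def PiE_def Pi_def)
    next
      case False
      then have "V j = ?T j" using n by auto
      then show ?thesis using y by (auto simp: cylinder_def topspace_tower_space)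
    qed
    then show "y \<in> U" using V by auto
  qed
  then show ?thesis by blast
qed

lemma openin_tower_space_iff:
  "openin (tower_space q) U \<longleftrightarrow>
     U \<subseteq> topspace (tower_space q) \<and> (\<forall>x \<in> U. \<exists>n. cylinder q n x \<subseteq> U)"
proof (intro iffI conjI ballI)
  assume *: "U \<subseteq> topspace (tower_space q) \<and> (\<forall>x \<in> U. \<exists>n. cylinder q n x \<subseteq> U)"
  show "openin (tower_space q) U"
  proof (subst openin_subopen, intro ballI)
    fix x assume "x \<in> U"
    with * obtain n where "cylinder q n x \<subseteq> U" "x \<in> topspace (tower_space q)" by blast
    then show "\<exists>V. openin (tower_space q) V \<and> x \<in> V \<and> V \<subseteq> U"
      by (intro exI[of _ "cylinder q n x"]) (simp add: openin_cylinder cylinder_refl)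
  qed
next
  assume "openin (tower_space q) U"
  then show "U \<subseteq> topspace (tower_space q)" by (rule openin_subset)
qed (rule openin_tower_space_imp_cylinder)

lemma in_closure_of_tower_space:
  assumes "x \<in> topspace (tower_space q)" "\<And>n. \<exists>y \<in> S. y \<in> cylinder q n x"
  shows "x \<in> tower_space q closure_of S"
  unfolding in_closure_of using assms openin_tower_space_imp_cylinder by (metis subset_iff)

lemma compact_space_tower_space: "compact_space (tower_space q)"
  by (simp add: tower_space_def compact_space_product_topology compact_space_discrete_topology)

lemma metrizable_space_tower_space: "metrizable_space (tower_space q)"
  by (simp add: tower_space_def metrizable_space_product_topology metrizable_space_discrete_topology)

text \<open>The point with the largest admissible coordinates attains \<open>q i - 1\<close> in
  plane \<open>i\<close>. Applied in both directions, this recovers \<open>q\<close> from the space,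
  which later keeps the family uncountable.\<close>

lemma tower_space_le:
  assumes "topspace (tower_space q) \<subseteq> topspace (tower_space q')" "\<And>i. 0 < q i"
  shows "q i \<le> q' i"
proof -
  have "(\<lambda>j. q (j div 2) - 1) \<in> topspace (tower_space q)"
    using assms(2) by (simp add: topspace_tower_space)
  then have "(\<lambda>j. q (j div 2) - 1) \<in> topspace (tower_space q')"
    using assms(1) by blast
  then have "\<forall>j. q (j div 2) - 1 < q' (j div 2)"
    by (simp add: topspace_tower_space)
  then have "q (2 * i div 2) - 1 < q' (2 * i div 2)" by blast
  then show ?thesis by simp
qed

text \<open>Uniformity in \<open>x\<close> comes from compactness: finitely many cylinders inside
  balls of radius \<open>\<epsilon> / 2\<close> cover the space, and the largest of their levels
  serves everywhere.\<close>

lemma mdist_small_on_cylinders: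
  assumes m: "mtopology_of m = tower_space q" and "\<epsilon> > 0"
  obtains n where "\<And>x y. x \<in> topspace (tower_space q) \<Longrightarrow> y \<in> cylinder q n x \<Longrightarrow> mdist m x y < \<epsilon>"
proof -
  interpret M: Metric_space "mspace m" "mdist m"
    by simp
  have T: "mspace m = topspace (tower_space q)"
    by (metis m topspace_mtopology_of)
  have op: "openin (tower_space q) (M.mball x r)" for x r
    using m unfolding mtopology_of_def by (metis M.openin_mball)
  have "\<exists>n. cylinder q n x \<subseteq> M.mball x (\<epsilon> / 2)" if "x \<in> topspace (tower_space q)" for x
    using op openin_tower_space_imp_cylinder M.centre_in_mball_iff that \<open>\<epsilon> > 0\<close> T
    by (metis half_gt_zero)
  then obtain N where
    N: "\<And>x. x \<in> topspace (tower_space q) \<Longrightarrow> cylinder q (N x) x \<subseteq> M.mball x (\<epsilon> / 2)"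
    by metis
  have "\<exists>\<F>. finite \<F> \<and> \<F> \<subseteq> (\<lambda>x. cylinder q (N x) x) ` topspace (tower_space q) \<and>
      topspace (tower_space q) \<subseteq> \<Union>\<F>"
  proof (rule compactinD)
    show "compactin (tower_space q) (topspace (tower_space q))"
      using compact_space_tower_space compact_space_def by blast
    show "topspace (tower_space q) \<subseteq> \<Union>((\<lambda>x. cylinder q (N x) x) ` topspace (tower_space q))"
      using cylinder_refl by fastforce
  qed (use openin_cylinder in blast)
  then obtain \<F> where \<F>: "finite \<F>" "\<F> \<subseteq> (\<lambda>x. cylinder q (N x) x) ` topspace (tower_space q)"
      "topspace (tower_space q) \<subseteq> \<Union>\<F>"
    by blast
  obtain F where "F \<subseteq> topspace (tower_space q)" "finite F" "\<F> = (\<lambda>x. cylinder q (N x) x) ` F"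
    using finite_subset_image[OF \<F>(1,2)] by blast
  with \<F>(3) have F: "finite F" "F \<subseteq> topspace (tower_space q)"
      "topspace (tower_space q) \<subseteq> (\<Union>x \<in> F. cylinder q (N x) x)"
    by simp_all
  show thesis
  proof (rule that[of "Max (insert 0 (N ` F))"])
    fix x y assume x: "x \<in> topspace (tower_space q)"
      and y: "y \<in> cylinder q (Max (insert 0 (N ` F))) x"
    obtain z where z: "z \<in> F" "x \<in> cylinder q (N z) z" using F x by blast
    have "N z \<le> Max (insert 0 (N ` F))" using z F by simp
    then have "y \<in> cylinder q (N z) z" using y z cylinder_mono cylinder_eq by blast
    then have "x \<in> M.mball z (\<epsilon> / 2)" "y \<in> M.mball z (\<epsilon> / 2)" using N z F by blast+
    then show "mdist m x y < \<epsilon>"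
      using M.triangle'[of x z y] by (auto simp: M.commute)
  qed
qed

text \<open>A Lebesgue number of the cover by cylinders of level \<open>n\<close> serves as
  \<open>\<delta>\<close>, because a cylinder of that level is determined by any of its
  points.\<close>

lemma in_cylinder_if_mdist_small:
  assumes m: "mtopology_of m = tower_space q"
  obtains \<delta> where "\<delta> > 0"
    "\<And>x y. x \<in> topspace (tower_space q) \<Longrightarrow> y \<in> topspace (tower_space q) \<Longrightarrow> mdist m x y < \<delta>
       \<Longrightarrow> y \<in> cylinder q n x"
proof -
  interpret M: Metric_space "mspace m" "mdist m"
    by simp
  have T: "mspace m = topspace (tower_space q)"
    by (metis m topspace_mtopology_of)
  have X: "M.mtopology = tower_space q"
    using m by (simp add: mtopology_of_def)
  have "\<exists>\<delta>>0. \<forall>x \<in> topspace (tower_space q). \<exists>U \<in> cylinder q n ` topspace (tower_space q).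
      M.mball x \<delta> \<subseteq> U"
    by (rule M.lebesgue_number)
      (use compact_space_tower_space openin_cylinder cylinder_refl in \<open>auto simp: X compact_space_def\<close>)
  then obtain \<delta> where \<delta>: "\<delta> > 0"
    "\<forall>x \<in> topspace (tower_space q). \<exists>U \<in> cylinder q n ` topspace (tower_space q). M.mball x \<delta> \<subseteq> U"
    by blast
  show thesis
  proof (rule that[OF \<delta>(1)])
    fix x y assume xy: "x \<in> topspace (tower_space q)" "y \<in> topspace (tower_space q)" "mdist m x y < \<delta>"
    then obtain z where z: "M.mball x \<delta> \<subseteq> cylinder q n z" using \<delta>(2) by blast
    moreover have "x \<in> M.mball x \<delta>" "y \<in> M.mball x \<delta>" using xy \<delta>(1)
      by (simp_all add: M.in_mball flip: T)
    ultimately have "x \<in> cylinder q n z" "y \<in> cylinder q n z" by blast+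
    then show "y \<in> cylinder q n x" by (metis cylinder_eq)
  qed
qed

section \<open>Plane-wise Heisenberg maps: congruences, composition, inverses, powers\<close>

locale prime_tower =
  fixes q :: "nat \<Rightarrow> nat"
  assumes prime_q: "prime (q i)" and inj_q: "inj q"
begin

abbreviation X :: "(nat \<Rightarrow> nat) topology" where "X \<equiv> tower_space q"

abbreviation T :: "(nat \<Rightarrow> nat) set" where "T \<equiv> topspace (tower_space q)"

lemma q_pos [simp]: "0 < q i"
  using prime_q by (simp add: prime_gt_0_nat)

lemma q_gt_1 [simp]: "Suc 0 < q i"
  using prime_q[of i] prime_gt_Suc_0_nat by blast

lemma zero_in_T: "(\<lambda>_. 0) \<in> T"
  by (simp add: topspace_tower_space)

lemma tower_map_in_T: "x \<in> T \<Longrightarrow> tower_map q a b c x \<in> T"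
  by (simp add: tower_map_def topspace_tower_space nat_less_iff)

text \<open>Each plane is acted on separately and only through residues modulo \<open>q i\<close>.
  Approximation thereby becomes a matter of finitely many congruences, and equal parameters yield
  preservation of levels.\<close>

lemma tower_map_cong:
  assumes x: "x \<in> T" and y: "y \<in> cylinder q n x"
    and *: "\<And>i. i < n \<Longrightarrow> [a i = a' i] (mod int (q i))" "\<And>i. i < n \<Longrightarrow> [b i = b' i] (mod int (q i))"
      "\<And>i. i < n \<Longrightarrow> [c i = c' i] (mod int (q i))"
  shows "tower_map q a b c y \<in> cylinder q n (tower_map q a' b' c' x)"
proof -
  have yT: "y \<in> T" using y by (simp add: cylinder_def)
  have "tower_map q a b c y j = tower_map q a' b' c' x j" if j: "j < 2 * n" for j
  proof (cases "even j")
    case True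
    \<comment> \<open>The new \<open>z\<close> coordinate also reads the \<open>y\<close> coordinate
      at \<open>Suc j\<close>; this is prescribed too, since an even \<open>j\<close> below
      \<open>2 * n\<close> has its successor below \<open>2 * n\<close>.\<close>
    have "j div 2 < n" "Suc j < 2 * n" using j True by auto
    then have "[int (y j) + a (j div 2) * int (y (Suc j)) + c (j div 2) =
        int (x j) + a' (j div 2) * int (x (Suc j)) + c' (j div 2)] (mod int (q (j div 2)))"
      using y j by (intro cong_add cong_mult *) (auto simp: cylinder_def)
    then show ?thesis using x yT True by (simp add: tower_map_def cong_def)
  next
    case False
    have "j div 2 < n" using j by auto
    then have "[int (y j) + b (j div 2) = int (x j) + b' (j div 2)] (mod int (q (j div 2)))"
      using y j by (intro cong_add *) (auto simp: cylinder_def)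
    then show ?thesis using x yT False by (simp add: tower_map_def cong_def)
  qed
  then show ?thesis using tower_map_in_T[OF yT] by (simp add: cylinder_def)
qed

lemma tower_map_cylinder:
  "x \<in> T \<Longrightarrow> y \<in> cylinder q n x \<Longrightarrow> tower_map q a b c y \<in> cylinder q n (tower_map q a b c x)"
  by (rule tower_map_cong) auto

lemma tower_map_zero: "x \<in> T \<Longrightarrow> tower_map q (\<lambda>_. 0) (\<lambda>_. 0) (\<lambda>_. 0) x = x"
  by (rule ext) (auto simp: tower_map_def topspace_tower_space)

lemma tower_map_cong_id:
  assumes "x \<in> T" "\<And>i. i < n \<Longrightarrow> int (q i) dvd a i" "\<And>i. i < n \<Longrightarrow> int (q i) dvd b i"
    "\<And>i. i < n \<Longrightarrow> int (q i) dvd c i"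
  shows "tower_map q a b c x \<in> cylinder q n x"
  using tower_map_cong[of x x n a "\<lambda>_. 0" b "\<lambda>_. 0" c "\<lambda>_. 0"] assms
  by (simp add: tower_map_zero cong_0_iff cylinder_refl)

text \<open>Plane by plane this is the product of Heisenberg matrices: the cross term
  \<open>a i * b' i\<close> arises because the outer shear acts on a \<open>y\<close> already
  translated by \<open>b' i\<close>.\<close>

lemma tower_map_comp:
  assumes x: "x \<in> T"
  shows "tower_map q a b c (tower_map q a' b' c' x) =
    tower_map q (\<lambda>i. a i + a' i) (\<lambda>i. b i + b' i) (\<lambda>i. c i + c' i + a i * b' i) x"
proof
  fix j
  let ?p = "int (q (j div 2))"
  show "tower_map q a b c (tower_map q a' b' c' x) j =
    tower_map q (\<lambda>i. a i + a' i) (\<lambda>i. b i + b' i) (\<lambda>i. c i + c' i + a i * b' i) x j"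
  proof (cases "even j")
    case True
    then have "tower_map q a b c (tower_map q a' b' c' x) j =
      nat (((int (x j) + a' (j div 2) * int (x (Suc j)) + c' (j div 2)) mod ?p
        + a (j div 2) * ((int (x (Suc j)) + b' (j div 2)) mod ?p) + c (j div 2)) mod ?p)"
      using x tower_map_in_T[OF x, of a' b' c'] by (simp add: tower_map_def)
    also have "\<dots> = nat ((int (x j) + a' (j div 2) * int (x (Suc j)) + c' (j div 2)
        + a (j div 2) * (int (x (Suc j)) + b' (j div 2)) + c (j div 2)) mod ?p)"
      by (intro arg_cong[of _ _ nat]) (unfold cong_def[symmetric], intro cong_add cong_scalar_left, simp_all)
    finally show ?thesis using x True by (simp only: tower_map_def restrict_apply) (simp only: algebra_simps if_True)
  next
    case False
    then have "tower_map q a b c (tower_map q a' b' c' x) j =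
      nat (((int (x j) + b' (j div 2)) mod ?p + b (j div 2)) mod ?p)"
      using x tower_map_in_T[OF x, of a' b' c'] by (simp add: tower_map_def)
    also have "\<dots> = nat ((int (x j) + b' (j div 2) + b (j div 2)) mod ?p)"
      by (simp add: mod_simps)
    finally show ?thesis using x False by (simp only: tower_map_def restrict_apply) (simp only: algebra_simps if_True if_False)
  qed
qed

lemma continuous_map_tower_map: "continuous_map X X (tower_map q a b c)"
proof -
  have "openin X {x \<in> T. tower_map q a b c x \<in> U}" if U: "openin X U" for U
    unfolding openin_tower_space_iff
  proof (intro conjI ballI)
    fix x assume x: "x \<in> {x \<in> T. tower_map q a b c x \<in> U}"
    then obtain n where "cylinder q n (tower_map q a b c x) \<subseteq> U"
      using U openin_tower_space_imp_cylinder by blast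
    then have "cylinder q n x \<subseteq> {x \<in> T. tower_map q a b c x \<in> U}"
      using x tower_map_cylinder cylinder_subset by blast
    then show "\<exists>n. cylinder q n x \<subseteq> {x \<in> T. tower_map q a b c x \<in> U}" by blast
  qed auto
  then show ?thesis
    by (simp add: continuous_map tower_map_in_T image_subset_iff)
qed

text \<open>The inverse matrix in each plane has corner entry \<open>a i * b i - c i\<close>, which
  absorbs the cross term of the product.\<close>

lemma homeomorphic_maps_tower_map:
  "homeomorphic_maps X X (tower_map q a b c)
     (tower_map q (\<lambda>i. - a i) (\<lambda>i. - b i) (\<lambda>i. a i * b i - c i))"
  unfolding homeomorphic_maps_def
proof (intro conjI ballI continuous_map_tower_map)
  fix x assume x: "x \<in> T"
  show "tower_map q (\<lambda>i. - a i) (\<lambda>i. - b i) (\<lambda>i. a i * b i - c i) (tower_map q a b c x) = x"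
    unfolding tower_map_comp[OF x] using tower_map_zero[OF x] by simp
  show "tower_map q a b c (tower_map q (\<lambda>i. - a i) (\<lambda>i. - b i) (\<lambda>i. a i * b i - c i) x) = x"
    unfolding tower_map_comp[OF x] using tower_map_zero[OF x] by simp
qed

lemma homeomorphic_map_tower_map: "homeomorphic_map X X (tower_map q a b c)"
  unfolding homeomorphic_map_maps by (rule exI, rule homeomorphic_maps_tower_map)

lemma tower_map_Bij: "tower_map q a b c \<in> Bij T"
proof -
  have "bij_betw (tower_map q a b c) T T"
    using homeomorphic_map_tower_map[of a b c] unfolding homeomorphic_eq_everything_map
    by (simp add: bij_betw_def)
  then show ?thesis by (simp add: Bij_def tower_map_def)
qed

text \<open>One more factor adds the cross term \<open>a * (int m * b)\<close>, so the corner entry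
  accumulates a triangular sum besides \<open>int m * c\<close>.\<close>

lemma tower_map_funpow:
  assumes "x \<in> T"
  shows "(tower_map q (\<lambda>_. a) (\<lambda>_. b) (\<lambda>_. c) ^^ m) x =
    tower_map q (\<lambda>_. int m * a) (\<lambda>_. int m * b) (\<lambda>_. int m * c + a * b * (\<Sum>i<m. int i)) x"
proof (induction m)
  case 0
  then show ?case using assms by (simp add: tower_map_zero)
next
  case (Suc m)
  then show ?case using assms by (simp add: tower_map_comp algebra_simps)
qed

section \<open>The Heisenberg actions\<close>

lemma group_action_heis_act: "group_action heisenberg_group T (heis_act q)"
proof -
  have "heis_act q \<in> hom heisenberg_group (BijGroup T)"
  proof (rule homI)
    fix A B assume AB: "A \<in> carrier heisenberg_group" "B \<in> carrier heisenberg_group"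
    then obtain a b c a' b' c' where eq: "A = heis a b c" "B = heis a' b' c'"
      by (metis carrier_heisenberg_groupE)
    have "heis_act q (heis (a + a') (b + b') (c + c' + a * b')) =
        compose T (heis_act q (heis a b c)) (heis_act q (heis a' b' c'))"
      by (rule extensionalityI[of _ T])
        (auto simp: heis_act_heis compose_def tower_map_comp, simp_all add: tower_map_def)
    then show "heis_act q (A \<otimes>\<^bsub>heisenberg_group\<^esub> B) =
        heis_act q A \<otimes>\<^bsub>BijGroup T\<^esub> heis_act q B"
      by (simp add: eq BijGroup_def heis_act_heis tower_map_Bij)
  qed (simp add: BijGroup_def heis_act_def tower_map_Bij)
  then show ?thesis
    by (simp add: group_action_def group_hom_def group_hom_axioms_def group_heisenberg_group
        group_BijGroup)
qed

section \<open>Minimality and equicontinuity\<close>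

lemma coprime_q: "i \<noteq> j \<Longrightarrow> coprime (q i) (q j)"
  using prime_q inj_q by (metis injD primes_coprime)

lemma chinese_remainder_q: "\<exists>z::int. \<forall>i<n. [z = u i] (mod int (q i))"
proof -
  \<comment> \<open>Passing to nonnegative representatives lets \<open>nat\<close> keep the residue
    classes, so the theorem for natural numbers applies.\<close>
  have "\<exists>z. \<forall>i \<in> {..<n}. [z = nat (u i mod int (q i))] (mod q i)"
    by (rule chinese_remainder_nat) (use coprime_q in blast)+
  then obtain z where z: "\<And>i. i < n \<Longrightarrow> [z = nat (u i mod int (q i))] (mod q i)"
    unfolding Ball_def lessThan_iff by blast
  have "[int z = u i] (mod int (q i))" if "i < n" for i
    using z[OF that] unfolding cong_int_iff[symmetric] by (simp add: cong_def)
  then show ?thesis by blast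
qed

lemma cantor_space_tower: "cantor_space X"
  unfolding cantor_space_def
proof (intro conjI ballI)
  show "T \<noteq> {}" using zero_in_T by blast
  fix x assume "x \<in> T"
  then have "x j \<in> {..<q (j div 2)}" for j by (simp add: topspace_tower_space)
  then show "connected_component_of_set X x = {x}"
    by (auto simp: tower_space_def connected_component_of_product_topology PiE_def Pi_def
        connected_component_of_discrete_topology)
next
  show "X derived_set_of T = T"
  proof (intro subset_antisym subsetI)
    fix x assume x: "x \<in> T"
    show "x \<in> X derived_set_of T"
      unfolding in_derived_set_of
    proof (intro conjI x allI impI)
      fix U assume U: "x \<in> U \<and> openin X U"
      then obtain n where n: "cylinder q n x \<subseteq> U"
        using openin_tower_space_imp_cylinder by blast
      \<comment> \<open>Coordinate \<open>2 * n\<close> is the first one left free. Truncated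
        subtraction turns \<open>0\<close> into \<open>1\<close> and everything else into
        \<open>0\<close>; both values are admissible because the primes exceed
        \<open>1\<close>.\<close>
      define y where "y = x(2 * n := 1 - x (2 * n))"
      have "y \<in> cylinder q n x"
        using x le_less_trans[OF diff_le_self q_gt_1]
        by (auto simp: y_def cylinder_def topspace_tower_space)
      moreover have "y \<noteq> x"
      proof
        assume "y = x"
        then have "y (2 * n) = x (2 * n)" by simp
        then show False by (cases "x (2 * n)") (simp_all add: y_def)
      qed
      ultimately show "\<exists>y. y \<noteq> x \<and> y \<in> T \<and> y \<in> U"
        using n cylinder_subset by blast
    qed
  qed (simp add: in_derived_set_of)
qed (simp_all add: compact_space_tower_space metrizable_space_tower_space)

text \<open>With \<open>a = 0\<close> the maps are translations, which carry any point of a plane to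
  any other; the Chinese remainder theorem realises the \<open>n\<close> required translations by
  one pair of integers. Minimality follows.\<close>

lemma heis_act_approx:
  assumes "x \<in> T" "y \<in> T"
  obtains A where "A \<in> carrier heisenberg_group" "heis_act q A x \<in> cylinder q n y"
proof -
  obtain b where b: "\<And>i. i < n \<Longrightarrow> [b = int (y (Suc (2 * i))) - int (x (Suc (2 * i)))] (mod int (q i))"
    using chinese_remainder_q[of n "\<lambda>i. int (y (Suc (2 * i))) - int (x (Suc (2 * i)))"] by blast
  obtain c where c: "\<And>i. i < n \<Longrightarrow> [c = int (y (2 * i)) - int (x (2 * i))] (mod int (q i))"
    using chinese_remainder_q[of n "\<lambda>i. int (y (2 * i)) - int (x (2 * i))"] by blast
  have "tower_map q (\<lambda>_. 0) (\<lambda>_. b) (\<lambda>_. c) x \<in> cylinder q n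
      (tower_map q (\<lambda>_. 0) (\<lambda>i. int (y (Suc (2 * i))) - int (x (Suc (2 * i))))
        (\<lambda>i. int (y (2 * i)) - int (x (2 * i))) x)"
    by (rule tower_map_cong) (auto simp: assms b c cylinder_refl)
  moreover have "tower_map q (\<lambda>_. 0) (\<lambda>i. int (y (Suc (2 * i))) - int (x (Suc (2 * i))))
        (\<lambda>i. int (y (2 * i)) - int (x (2 * i))) x = y"
    using assms by (intro ext) (auto simp: tower_map_def topspace_tower_space odd_two_times_div_two_succ)
  ultimately show thesis
    using that[of "heis 0 b c"] by (simp add: heis_act_heis)
qed

lemma cantor_action_heis_act: "cantor_action X heisenberg_group (heis_act q)"
  unfolding cantor_action_def
proof (intro conjI ballI)
  fix x assume x: "x \<in> T"
  have "y \<in> X closure_of (orbit heisenberg_group (heis_act q) x)" if y: "y \<in> T" for y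
  proof (rule in_closure_of_tower_space[OF y])
    fix n
    obtain A where "A \<in> carrier heisenberg_group" "heis_act q A x \<in> cylinder q n y"
      by (rule heis_act_approx[OF x y])
    then show "\<exists>z \<in> orbit heisenberg_group (heis_act q) x. z \<in> cylinder q n y"
      unfolding orbit_def by blast
  qed
  then show "X closure_of (orbit heisenberg_group (heis_act q) x) = T"
    by (intro subset_antisym closure_of_subset_topspace subsetI)
qed (simp_all add: cantor_space_tower countable_heisenberg_group group_action_heis_act
    heis_act_def homeomorphic_map_tower_map)

text \<open>Every group element carries points sharing a cylinder of level \<open>n\<close> to
  points sharing one, so a \<open>\<delta>\<close> that forces a common small cylinder works for all
  elements at once.\<close>

lemma equicontinuous_heis_act: "equicontinuous_action X heisenberg_group (heis_act q)"
proof -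
  obtain M d where "Metric_space M d" "X = Metric_space.mtopology M d"
    using metrizable_space_tower_space unfolding metrizable_space_def by blast
  then obtain m where m: "mtopology_of m = X"
    using Metric_space.mtopology_of by metis
  have "\<exists>\<delta>>0. \<forall>x \<in> T. \<forall>y \<in> T. mdist m x y < \<delta> \<longrightarrow>
      (\<forall>g \<in> carrier heisenberg_group. mdist m (heis_act q g x) (heis_act q g y) < \<epsilon>)"
    if eps: "\<epsilon> > 0" for \<epsilon>
  proof -
    obtain n where n: "\<And>x y. x \<in> T \<Longrightarrow> y \<in> cylinder q n x \<Longrightarrow> mdist m x y < \<epsilon>"
      using mdist_small_on_cylinders[OF m eps] by blast
    obtain \<delta> where \<delta>: "\<delta> > 0"
      "\<And>x y. x \<in> T \<Longrightarrow> y \<in> T \<Longrightarrow> mdist m x y < \<delta> \<Longrightarrow> y \<in> cylinder q n x"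
      using in_cylinder_if_mdist_small[OF m, of n] by blast
    show ?thesis
      unfolding heis_act_def
      by (intro exI[of _ \<delta>] conjI ballI impI n tower_map_cylinder tower_map_in_T \<delta>)
  qed
  then show ?thesis unfolding equicontinuous_action_def using m by blast
qed

section \<open>Fixed points and topological freeness\<close>

lemma unbounded_q: "\<exists>i\<ge>n. q i > k"
proof (rule ccontr)
  assume "\<not> (\<exists>i\<ge>n. q i > k)"
  then have "q ` {n..} \<subseteq> {..k}" by (auto simp: not_less)
  then have "finite {n..}"
    by (metis finite_atMost finite_imageD finite_subset inj_on_subset inj_q subset_UNIV)
  then show False by (simp add: infinite_Ici)
qed

lemma eq_0_if_almost_all_dvd:
  fixes z :: int
  assumes "\<And>i. i \<ge> n \<Longrightarrow> int (q i) dvd z"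
  shows "z = 0"
proof -
  obtain i where i: "i \<ge> n" "q i > nat \<bar>z\<bar>" using unbounded_q by blast
  then have "\<not> \<bar>int (q i)\<bar> \<le> \<bar>z\<bar>" by linarith
  then show ?thesis using dvd_imp_le_int[OF _ assms[OF i(1)]] by blast
qed

text \<open>An open set contains a cylinder, which leaves all planes beyond its level unrestricted.
  Fixing the points of such a plane forces congruences modulo \<open>q i\<close>, and congruences
  modulo almost all of the primes are equations.\<close>

lemma interior_fixed_points:
  assumes W: "openin X W" "W \<noteq> {}" and fixed: "\<And>x. x \<in> W \<Longrightarrow> heis_act q (heis a b c) x = x"
  shows "a = 0" "b = 0" "c = 0"
proof -
  obtain x n where x: "x \<in> W" "cylinder q n x \<subseteq> W"
    using W openin_tower_space_imp_cylinder by blast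
  have xT: "x \<in> T" using x W openin_subset by blast
  have eqs: "int (q i) dvd a * int v + c" "int (q i) dvd b" if i: "i \<ge> n" and v: "v < q i" for i v
  proof -
    \<comment> \<open>In plane \<open>i\<close>, which the cylinder leaves free, the test point is
      \<open>(0, v)\<close>; its image there is \<open>(a * v + c, v + b)\<close> modulo
      \<open>q i\<close>.\<close>
    define y where "y = x(2 * i := 0, Suc (2 * i) := v)"
    have "y \<in> cylinder q n x"
      using xT i v by (auto simp: y_def cylinder_def topspace_tower_space)
    then have yT: "y \<in> T" and yW: "y \<in> W"
      using x cylinder_subset by blast+
    have eq: "tower_map q (\<lambda>_. a) (\<lambda>_. b) (\<lambda>_. c) y = y"
      using fixed[OF yW] by (simp add: heis_act_heis)
    have "nat ((a * int v + c) mod int (q i)) = 0"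
      using fun_cong[OF eq, of "2 * i"] yT by (simp add: tower_map_def y_def)
    then show "int (q i) dvd a * int v + c"
      by (metis q_pos dvd_eq_mod_eq_0 nat_0_iff of_nat_0_less_iff order_antisym pos_mod_sign)
    have "nat ((int v + b) mod int (q i)) = v"
      using fun_cong[OF eq, of "Suc (2 * i)"] yT by (simp add: tower_map_def y_def)
    then have "(int v + b) mod int (q i) = int v mod int (q i)"
      using v by (metis int_nat_eq mod_less of_nat_0_less_iff pos_mod_sign q_pos zmod_int)
    then show "int (q i) dvd b"
      by (metis add_diff_cancel_left' mod_eq_dvd_iff)
  qed
  show "b = 0" by (rule eq_0_if_almost_all_dvd[of n]) (use eqs(2)[of _ 0] in simp)
  show c: "c = 0" by (rule eq_0_if_almost_all_dvd[of n]) (use eqs(1)[of _ 0] in simp)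
  \<comment> \<open>Once \<open>c = 0\<close> is known, the test value \<open>v = 1\<close> isolates
    \<open>a\<close>.\<close>
  show "a = 0" by (rule eq_0_if_almost_all_dvd[of n]) (use eqs(1)[of _ 1] c in simp)
qed

lemma closedin_fixed_points: "closedin X {x \<in> T. heis_act q A x = x}"
  unfolding closedin_def openin_tower_space_iff
proof (intro conjI ballI)
  fix x assume "x \<in> T - {x \<in> T. heis_act q A x = x}"
  then have x: "x \<in> T" "heis_act q A x \<noteq> x" by auto
  then obtain j where j: "heis_act q A x j \<noteq> x j" by blast
  \<comment> \<open>Level \<open>Suc j\<close> prescribes coordinate \<open>j\<close> of the point
    and of its image, as \<open>j < 2 * Suc j\<close>; a discrepancy there persists on the whole
    cylinder.\<close>
  have "heis_act q A y j = heis_act q A x j" "y j = x j" if y: "y \<in> cylinder q (Suc j) x" for y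
    using tower_map_cylinder[OF x(1) y] y by (auto simp: heis_act_def cylinder_def)
  then have "cylinder q (Suc j) x \<subseteq> T - {x \<in> T. heis_act q A x = x}"
    using j cylinder_subset by fastforce
  then show "\<exists>n. cylinder q n x \<subseteq> T - {x \<in> T. heis_act q A x = x}" by blast
qed auto

text \<open>Each of the countably many nontrivial elements contributes a closed fixed point set with
  empty interior.\<close>

lemma topologically_free_heis_act: "topologically_free X heisenberg_group (heis_act q)"
  unfolding topologically_free_def meager_in_def
proof (intro exI conjI ballI)
  let ?Fix = "\<lambda>A. {x \<in> T. heis_act q A x = x}"
  let ?\<A> = "?Fix ` (carrier heisenberg_group - {\<one>\<^bsub>heisenberg_group\<^esub>})"
  show "countable ?\<A>" using countable_heisenberg_group by blast
  show "{x \<in> T. \<exists>g \<in> carrier heisenberg_group. g \<noteq> \<one>\<^bsub>heisenberg_group\<^esub> \<and> heis_act q g x = x} = \<Union>?\<A>"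
    by auto
  fix F assume "F \<in> ?\<A>"
  then obtain A where A: "A \<in> carrier heisenberg_group" "A \<noteq> \<one>\<^bsub>heisenberg_group\<^esub>" and F: "F = ?Fix A"
    by blast
  then obtain a b c where abc: "A = heis a b c" by (metis carrier_heisenberg_groupE)
  show "F \<subseteq> T" by (auto simp: F)
  have "X closure_of F = F" using closedin_fixed_points F closure_of_closedin by blast
  moreover have "X interior_of F = {}"
  proof (rule ccontr)
    assume ne: "X interior_of F \<noteq> {}"
    have "heis_act q (heis a b c) x = x" if "x \<in> X interior_of F" for x
      using that interior_of_subset[of X F] F abc by blast
    then have "a = 0" "b = 0" "c = 0"
      using interior_fixed_points[OF openin_interior_of ne] by blast+
    then show False using A abc heis_one by simp
  qed
  ultimately show "X interior_of (X closure_of F) = {}" by simp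
qed

section \<open>The closure group and wildness\<close>

lemma tower_map_approx:
  obtains A where "A \<in> carrier heisenberg_group"
    "\<And>x. x \<in> T \<Longrightarrow> heis_act q A x \<in> cylinder q n (tower_map q a b c x)"
proof -
  \<comment> \<open>The three residue problems are solved independently of each other and of
    \<open>x\<close>; a single matrix for all points is what uniform approximation requires.\<close>
  obtain a' b' c' where "\<And>i. i < n \<Longrightarrow> [a' = a i] (mod int (q i))"
    "\<And>i. i < n \<Longrightarrow> [b' = b i] (mod int (q i))" "\<And>i. i < n \<Longrightarrow> [c' = c i] (mod int (q i))"
    using chinese_remainder_q[of n a] chinese_remainder_q[of n b] chinese_remainder_q[of n c] by blast
  then have "heis_act q (heis a' b' c') x \<in> cylinder q n (tower_map q a b c x)" if "x \<in> T" for x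
    unfolding heis_act_heis using that by (intro tower_map_cong cylinder_refl)
  then show thesis using that heis_carrier by blast
qed

lemma tower_map_in_uniform_topology:
  assumes m: "mtopology_of m = X"
  shows "tower_map q a b c \<in> mspace (cfunspace (mtopology_of m) m)"
    "tower_map q a b c \<in> homeo_set (mtopology_of m)"
proof -
  interpret M: Metric_space "mspace m" "mdist m"
    by simp
  have T: "mspace m = T"
    by (metis m topspace_mtopology_of)
  have "compactin M.mtopology (mspace m)"
    using compact_space_tower_space m T by (simp add: mtopology_of_def compact_space_def)
  then have "M.mbounded (mspace m)"
    by (rule M.compactin_imp_mbounded)
  moreover have sub: "tower_map q a b c ` T \<subseteq> mspace m"
    using tower_map_in_T T by blast
  ultimately have bdd: "M.mbounded (tower_map q a b c ` T)"
    using M.mbounded_subset by blast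
  have ext: "tower_map q a b c \<in> extensional T"
    by (simp add: tower_map_def)
  show "tower_map q a b c \<in> mspace (cfunspace (mtopology_of m) m)"
    using bdd sub ext continuous_map_tower_map by (auto simp: m)
  show "tower_map q a b c \<in> homeo_set (mtopology_of m)"
    unfolding m homeo_set_def using ext homeomorphic_map_tower_map by blast
qed

text \<open>A matrix agreeing with the given sequences modulo the first \<open>n\<close> primes is
  uniformly close to the map once cylinders of level \<open>n\<close> are small.\<close>

lemma tower_map_in_closure_group:
  assumes m: "mtopology_of m = X"
  shows "tower_map q a b c \<in> carrier (closure_group m heisenberg_group (heis_act q))"
proof -
  let ?C = "cfunspace X m"
  let ?g = "tower_map q a b c"
  interpret C: Metric_space "mspace ?C" "mdist ?C"
    by (rule Metric_space_mspace_mdist)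
  have ut: "uniform_topology m = subtopology (mtopology_of ?C) (homeo_set X)"
    by (simp only: uniform_topology_def m)
  have mem: "tower_map q a b c \<in> mspace ?C" "tower_map q a b c \<in> homeo_set X" for a b c
    using tower_map_in_uniform_topology[OF m] by (simp_all only: m)
  have "\<exists>f. f \<in> heis_act q ` carrier heisenberg_group \<and> f \<in> W"
    if W: "?g \<in> W" "openin (uniform_topology m) W" for W
  proof -
    obtain W' where W': "openin (mtopology_of ?C) W'" "W = W' \<inter> homeo_set X"
      using W(2) unfolding ut openin_subtopology by blast
    then obtain r where r: "r > 0" "C.mball ?g r \<subseteq> W'"
      using W(1) unfolding mtopology_of_def C.openin_mtopology by blast
    \<comment> \<open>A strict pointwise bound passes to the supremum only as a nonstrict one;
      halving the radius restores strictness.\<close>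
    have r2: "r / 2 > 0" using r by simp
    obtain n where n: "\<And>x y. x \<in> T \<Longrightarrow> y \<in> cylinder q n x \<Longrightarrow> mdist m x y < r / 2"
      using mdist_small_on_cylinders[OF m r2] by blast
    obtain A where A: "A \<in> carrier heisenberg_group"
      "\<And>x. x \<in> T \<Longrightarrow> heis_act q A x \<in> cylinder q n (?g x)"
      using tower_map_approx by blast
    have "mdist ?C ?g (heis_act q A) \<le> r / 2"
    proof (rule mdist_cfunspace_le)
      fix x assume "x \<in> T"
      then show "mdist m (?g x) (heis_act q A x) \<le> r / 2"
        by (intro less_imp_le n tower_map_in_T A)
    qed (use r2 in simp)
    then have "mdist ?C ?g (heis_act q A) < r" using r(1) by simp
    then have "heis_act q A \<in> C.mball ?g r"
      unfolding C.in_mball heis_act_def using mem(1) by blast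
    then have "heis_act q A \<in> W"
      using r W' mem(2) unfolding heis_act_def by blast
    then show ?thesis using A(1) by blast
  qed
  moreover have "?g \<in> topspace (uniform_topology m)"
    unfolding ut topspace_subtopology topspace_mtopology_of using mem by blast
  ultimately have "?g \<in> uniform_topology m closure_of (heis_act q ` carrier heisenberg_group)"
    unfolding in_closure_of by blast
  then show ?thesis by (simp add: closure_group_def)
qed

text \<open>The shear of the \<open>k\<close>-th plane alone fixes a cylinder of level \<open>k + 1\<close> pointwise, but not the
  cylinder of level \<open>k\<close> containing it.\<close>

lemma wild_heis_act: "wild_action X heisenberg_group (heis_act q)"
  unfolding wild_action_def stable_action_def
proof
  assume "\<exists>m. mtopology_of m = X \<and>
    locally_quasi_analytic m (closure_group m heisenberg_group (heis_act q)) (\<lambda>f. f)"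
  then obtain m \<epsilon> where m: "mtopology_of m = X" and "\<epsilon> > 0"
    and lqa: "\<And>U V g. openin X U \<Longrightarrow> U \<noteq> {} \<Longrightarrow> mdiameter m U < \<epsilon> \<Longrightarrow> openin X V \<Longrightarrow> V \<noteq> {} \<Longrightarrow> V \<subseteq> U
      \<Longrightarrow> g \<in> carrier (closure_group m heisenberg_group (heis_act q)) \<Longrightarrow> g ` V = V
      \<Longrightarrow> (\<And>x. x \<in> V \<Longrightarrow> g x = x) \<Longrightarrow> \<forall>x \<in> U. g x = x"
    unfolding locally_quasi_analytic_def by (smt (verit, best))
  have e2: "\<epsilon> / 2 > 0" using \<open>\<epsilon> > 0\<close> by simp
  \<comment> \<open>The level \<open>k\<close> is chosen after \<open>\<epsilon>\<close>, so that
    the cylinder \<open>?U\<close> is small enough for the supposed local quasi-analyticity.\<close>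
  obtain k where k: "\<And>x y. x \<in> T \<Longrightarrow> y \<in> cylinder q k x \<Longrightarrow> mdist m x y < \<epsilon> / 2"
    using mdist_small_on_cylinders[OF m e2] by blast
  define o0 :: "nat \<Rightarrow> nat" where "o0 = (\<lambda>_. 0)"
  have o0: "o0 \<in> T" unfolding o0_def by (rule zero_in_T)
  define g where "g = tower_map q (\<lambda>i. of_bool (i = k)) (\<lambda>_. 0) (\<lambda>_. 0)"
  let ?U = "cylinder q k o0" and ?V = "cylinder q (Suc k) o0"
  have "mdiameter m ?U \<le> \<epsilon> / 2"
  proof -
    have "mdist m x y \<le> \<epsilon> / 2" if "x \<in> ?U" "y \<in> ?U" for x y
    proof (rule less_imp_le, rule k)
      show "x \<in> T" using that(1) cylinder_subset by blast
      show "y \<in> cylinder q k x" using that(2) cylinder_eq[OF that(1)] by simp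
    qed
    moreover have ne: "?U \<noteq> {}" using cylinder_refl[OF o0] by blast
    ultimately have "(SUP (x, y) \<in> ?U \<times> ?U. mdist m x y) \<le> \<epsilon> / 2"
      by (intro cSUP_least) auto
    with ne show ?thesis by (simp only: mdiameter_def if_False)
  qed
  then have diam: "mdiameter m ?U < \<epsilon>" using \<open>\<epsilon> > 0\<close> by simp
  have fixV: "g x = x" if x: "x \<in> ?V" for x
  proof
    fix j
    have xT: "x \<in> T" using x cylinder_subset by blast
    then have lt: "x j < q (j div 2)" by (simp add: topspace_tower_space)
    have zero: "x (Suc (2 * k)) = 0" using x by (simp add: cylinder_def o0_def)
    show "g x j = x j"
    proof (cases "even j \<and> j div 2 = k")
      case True
      then have "j = 2 * k" by presburger
      then show ?thesis using xT lt zero by (simp add: g_def tower_map_def)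
    next
      case False
      then show ?thesis using xT lt by (auto simp: g_def tower_map_def)
    qed
  qed
  have "\<forall>x \<in> ?U. g x = x"
  proof (rule lqa[OF openin_cylinder _ diam openin_cylinder])
    show "g \<in> carrier (closure_group m heisenberg_group (heis_act q))"
      unfolding g_def by (rule tower_map_in_closure_group[OF m])
    show "?U \<noteq> {}" "?V \<noteq> {}" using cylinder_refl[OF o0] by blast+
    show "?V \<subseteq> ?U" by (rule cylinder_mono) simp
    show "g ` ?V = ?V" using fixV by force
  qed (rule fixV)
  \<comment> \<open>This point is \<open>(0, 1)\<close> in plane \<open>k\<close>; the shear adds
    \<open>y = 1\<close> to \<open>z\<close> and moves it to \<open>(1, 1)\<close>.\<close>
  moreover define x where "x = o0(Suc (2 * k) := 1)"
  moreover have "x \<in> ?U" by (auto simp: x_def o0_def cylinder_def topspace_tower_space)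
  ultimately have "g x (2 * k) = x (2 * k)" by simp
  moreover have "x \<in> T" using \<open>x \<in> ?U\<close> cylinder_subset by blast
  ultimately show False
    by (simp add: g_def tower_map_def) (simp add: x_def o0_def zmod_trivial_iff)
qed

end

section \<open>An invariant of return equivalence\<close>

text \<open>Quantifying over \<open>g\<close> makes the property independent of how an isomorphism
  relabels the group; quantifying over \<open>W\<close> makes it local. The primes having it
  separate the actions.\<close>

definition divides_return_times :: "'x topology \<Rightarrow> ('x \<Rightarrow> 'x) set \<Rightarrow> nat \<Rightarrow> bool" where
  "divides_return_times Y H p \<longleftrightarrow>
     (\<exists>g \<in> H. \<exists>W. openin Y W \<and> W \<noteq> {} \<and> (\<forall>m. \<forall>x \<in> W. (g ^^ m) x \<in> W \<longrightarrow> p dvd m))"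

text \<open>The conjugacy \<open>h\<close> carries orbits of \<open>g\<close> to orbits of
  \<open>\<Theta> g\<close>, hence \<open>W\<close> to its image with the same return times.\<close>

lemma divides_return_times_isomorphic:
  assumes iso: "isomorphic_actions Y1 H1 (\<lambda>f. f) Y2 H2 (\<lambda>f. f)"
    and inv: "\<forall>g \<in> carrier H2. \<forall>y \<in> topspace Y2. g y \<in> topspace Y2"
    and div: "divides_return_times Y1 (carrier H1) p"
  shows "divides_return_times Y2 (carrier H2) p"
proof -
  obtain h h' \<Theta> where hh: "homeomorphic_maps Y1 Y2 h h'" and \<Theta>: "\<Theta> \<in> iso H1 H2"
    and eq: "\<And>g y. g \<in> carrier H1 \<Longrightarrow> y \<in> topspace Y1 \<Longrightarrow> g y = h' (\<Theta> g (h y))"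
    using iso unfolding isomorphic_actions_def by blast
  obtain g W where g: "g \<in> carrier H1" and W: "openin Y1 W" "W \<noteq> {}"
    and dvd: "\<And>m x. x \<in> W \<Longrightarrow> (g ^^ m) x \<in> W \<Longrightarrow> p dvd m"
    using div unfolding divides_return_times_def by blast
  have \<Theta>g: "\<Theta> g \<in> carrier H2"
    using \<Theta> g by (auto simp: iso_def hom_def)
  have h: "h y \<in> topspace Y2" "h' (h y) = y" if "y \<in> topspace Y1" for y
    using hh that by (auto simp: homeomorphic_maps_def continuous_map_def)
  have h': "h' z \<in> topspace Y1" "h (h' z) = z" if "z \<in> topspace Y2" for z
    using hh that by (auto simp: homeomorphic_maps_def continuous_map_def)
  have WY: "W \<subseteq> topspace Y1" using W(1) by (rule openin_subset)
  have iter: "(g ^^ m) x \<in> topspace Y1 \<and> (\<Theta> g ^^ m) (h x) = h ((g ^^ m) x)"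
    if x: "x \<in> topspace Y1" for m x
  proof (induction m)
    case (Suc m)
    \<comment> \<open>Cancelling \<open>h'\<close> in the conjugacy equation is possible on
      \<open>topspace Y2\<close>; the assumption \<open>inv\<close> places the value there.\<close>
    then have "\<Theta> g (h ((g ^^ m) x)) \<in> topspace Y2" using inv \<Theta>g h by blast
    then show ?case using Suc h' eq[OF g] by simp
  qed (use x in simp)
  have "openin Y2 (h ` W)"
    using homeomorphic_imp_open_map[OF homeomorphic_maps_imp_map[OF hh]] W(1)
    by (simp add: open_map_def)
  moreover have "p dvd m" if z: "z \<in> h ` W" and iz: "(\<Theta> g ^^ m) z \<in> h ` W" for m z
  proof -
    obtain x where x: "x \<in> W" "z = h x" using z by blast
    obtain w where w: "w \<in> W" "(\<Theta> g ^^ m) (h x) = h w" using iz x by blast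
    then have "h ((g ^^ m) x) = h w" using iter x WY by (metis subsetD)
    then have "(g ^^ m) x = w" using h(2) iter w x WY by (metis subsetD)
    then show ?thesis using dvd x w by blast
  qed
  ultimately show ?thesis
    unfolding divides_return_times_def using \<Theta>g W(2) by blast
qed

section \<open>Return times of the Heisenberg actions\<close>

context prime_tower
begin

lemma holonomy_group_closed:
  assumes "adapted X heisenberg_group (heis_act q) U"
    and "g \<in> carrier (holonomy_group heisenberg_group (heis_act q) U)" "y \<in> U"
  shows "g y \<in> U"
proof -
  obtain A where "A \<in> return_set heisenberg_group (heis_act q) U" "g = restrict (heis_act q A) U"
    using assms(2) by (auto simp: holonomy_group_def)
  moreover from this(1) have "heis_act q A ` U = U"
    using assms(1) by (simp add: adapted_def return_set_def)
  ultimately show ?thesis using assms(3) by auto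
qed

lemma restrict_funpow:
  assumes "\<And>y. y \<in> U \<Longrightarrow> f y \<in> U" "x \<in> U"
  shows "(restrict f U ^^ m) x = (f ^^ m) x \<and> (f ^^ m) x \<in> U"
  using assms by (induction m) auto

text \<open>A central element whose corner entry is divisible by all earlier primes leaves the
  earlier planes alone and so returns to \<open>U\<close>, whereas it translates plane
  \<open>i\<close> by a unit modulo \<open>q i\<close>. Coming back in that plane takes a multiple
  of \<open>q i\<close> steps.\<close>

lemma divides_return_times_tower:
  assumes U: "adapted X heisenberg_group (heis_act q) U"
  obtains N where "\<And>i. i \<ge> N \<Longrightarrow>
    divides_return_times (subtopology X U)
      (carrier (holonomy_group heisenberg_group (heis_act q) U)) (q i)"
proof -
  obtain x0 where x0: "x0 \<in> U" and op: "openin X U"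
    using U unfolding adapted_def by blast
  have UT: "U \<subseteq> T" using op by (rule openin_subset)
  obtain N where N: "cylinder q N x0 \<subseteq> U"
    using openin_tower_space_imp_cylinder[OF op x0] by blast
  show thesis
  proof (rule that[of N])
    fix i assume i: "i \<ge> N"
    define M where "M = (\<Prod>k<i. q k)"
    let ?A = "heis 0 0 (int M)"
    let ?f = "heis_act q ?A"
    \<comment> \<open>One level more than the \<open>i\<close> planes left alone: \<open>?W\<close>
      also prescribes plane \<open>i\<close>, where the return times are read off.\<close>
    let ?W = "cylinder q (Suc i) x0"
    have dvd: "int (q k) dvd int M" if "k < i" for k
      unfolding M_def of_nat_dvd_iff using that by (intro dvd_prodI) auto
    have "?f x0 \<in> cylinder q i x0"
      unfolding heis_act_heis using x0 UT dvd by (intro tower_map_cong_id) auto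
    then have "?f x0 \<in> U" using cylinder_mono[OF i] N by blast
    then have "?f ` U \<inter> U \<noteq> {}" using x0 by blast
    then have ret: "?A \<in> return_set heisenberg_group (heis_act q) U"
      by (simp add: return_set_def)
    then have "?f ` U = U" using U by (auto simp: adapted_def return_set_def)
    then have closed: "?f y \<in> U" if "y \<in> U" for y using that by blast
    have WU: "?W \<subseteq> U" using cylinder_mono[of N "Suc i" q x0] i N by auto
    then have "openin (subtopology X U) ?W"
      by (simp add: openin_cylinder openin_subtopology_Int2 openin_open_subtopology op)
    moreover have "?W \<noteq> {}" using cylinder_refl x0 UT by blast
    moreover have "q i dvd m" if x: "x \<in> ?W" and ret: "(restrict ?f U ^^ m) x \<in> ?W" for m x
    proof -
      have xT: "x \<in> T" using x WU UT by blast
      have "(restrict ?f U ^^ m) x = (?f ^^ m) x"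
        using restrict_funpow[of U ?f x m] closed x WU by blast
      also have "\<dots> = tower_map q (\<lambda>_. 0) (\<lambda>_. 0) (\<lambda>_. int m * int M) x"
        unfolding heis_act_heis using tower_map_funpow[OF xT, where a = 0 and b = 0] by simp
      finally have "tower_map q (\<lambda>_. 0) (\<lambda>_. 0) (\<lambda>_. int m * int M) x (2 * i) = x (2 * i)"
        using ret x by (simp add: cylinder_def)
      then have "nat ((int (x (2 * i)) + int m * int M) mod int (q i)) = x (2 * i)"
        using xT by (simp add: tower_map_def)
      then have "(x (2 * i) + m * M) mod q i = x (2 * i)"
        by (metis nat_int of_nat_add of_nat_mult zmod_int)
      then have "[x (2 * i) + m * M = x (2 * i)] (mod q i)"
        by (metis cong_def mod_mod_trivial)
      then have "q i dvd m * M" by (simp add: cong_add_lcancel_0_nat cong_0_iff)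
      moreover have "coprime (q i) M"
        unfolding M_def by (intro prod_coprime_right coprime_q) auto
      ultimately show "q i dvd m" by (simp add: coprime_dvd_mult_left_iff)
    qed
    moreover have "restrict ?f U \<in> carrier (holonomy_group heisenberg_group (heis_act q) U)"
      unfolding holonomy_group_def using ret by simp
    ultimately show "divides_return_times (subtopology X U)
        (carrier (holonomy_group heisenberg_group (heis_act q) U)) (q i)"
      unfolding divides_return_times_def by blast
  qed
qed

text \<open>For every element and open set some positive return time has only \<open>2\<close> and
  primes \<open>q k\<close> as prime factors: a suitable power acts trivially on the finitely many
  planes prescribed by a cylinder inside \<open>W\<close>. An odd prime dividing it is then some
  \<open>q k\<close>.\<close>

lemma divides_return_times_imp_range:
  assumes U: "adapted X heisenberg_group (heis_act q) U"
    and div: "divides_return_times (subtopology X U)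
      (carrier (holonomy_group heisenberg_group (heis_act q) U)) p"
    and p: "prime p" "p \<noteq> 2"
  shows "p \<in> range q"
proof -
  have op: "openin X U" using U by (simp add: adapted_def)
  obtain g W where g: "g \<in> carrier (holonomy_group heisenberg_group (heis_act q) U)"
    and W: "openin (subtopology X U) W" "W \<noteq> {}"
    and dvd: "\<And>m x. x \<in> W \<Longrightarrow> (g ^^ m) x \<in> W \<Longrightarrow> p dvd m"
    using div unfolding divides_return_times_def by blast
  obtain A where A: "A \<in> carrier heisenberg_group" and gA: "g = restrict (heis_act q A) U"
    and "heis_act q A ` U \<inter> U \<noteq> {}"
    using g by (auto simp: holonomy_group_def return_set_def)
  then have "heis_act q A ` U = U" using U by (simp add: adapted_def)
  then have closed: "heis_act q A y \<in> U" if "y \<in> U" for y using that by blast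
  obtain a b c where abc: "A = heis a b c" using A by (rule carrier_heisenberg_groupE)
  have opW: "openin X W" "W \<subseteq> U" using W(1) op by (simp_all add: openin_open_subtopology)
  obtain x where x: "x \<in> W" using W by blast
  then have xT: "x \<in> T" using opW openin_subset by blast
  obtain n where n: "cylinder q n x \<subseteq> W"
    using openin_tower_space_imp_cylinder[OF opW(1) x] by blast
  define M where "M = (\<Prod>k<n. q k)"
  \<comment> \<open>The factor \<open>2\<close> compensates for the halving in the triangular sum:
    \<open>m * (m - 1) / 2\<close> becomes \<open>M * (2 * M - 1)\<close>, still divisible by every
    \<open>q k\<close> with \<open>k < n\<close>.\<close>
  define m where "m = 2 * M"
  have M: "int (q k) dvd int M" if "k < n" for k
    unfolding M_def of_nat_dvd_iff using that by (intro dvd_prodI) auto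
  have "2 * (\<Sum>i<m. int i) = int m * (int m - 1)" for m :: nat
    by (induction m) (simp_all add: algebra_simps)
  from this[of m] have sum: "(\<Sum>i<m. int i) = int M * (2 * int M - 1)"
    by (simp add: m_def)
  have dvdm: "int (q k) dvd int m" if "k < n" for k
    unfolding m_def of_nat_mult by (rule dvd_mult[OF M[OF that]])
  have dvdsum: "int (q k) dvd (\<Sum>i<m. int i)" if "k < n" for k
    unfolding sum by (rule dvd_mult2[OF M[OF that]])
  have "(g ^^ m) x = (heis_act q A ^^ m) x"
    unfolding gA using restrict_funpow[of U "heis_act q A" x m] closed x opW by blast
  also have "\<dots> = tower_map q (\<lambda>_. int m * a) (\<lambda>_. int m * b)
      (\<lambda>_. int m * c + a * b * (\<Sum>i<m. int i)) x"
    unfolding abc heis_act_heis by (rule tower_map_funpow[OF xT])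
  also have "\<dots> \<in> cylinder q n x"
    by (rule tower_map_cong_id[OF xT]) (intro dvd_add dvd_mult2[OF dvdm] dvd_mult[OF dvdsum]; assumption)+
  finally have "p dvd m" using dvd x n by blast
  then have "p dvd M"
    using p by (metis m_def prime_dvd_mult_iff primes_dvd_imp_eq two_is_prime_nat)
  then obtain k where "p dvd q k"
    unfolding M_def using p(1) by (auto simp: prime_dvd_prod_iff)
  then have "p = q k" using p(1) prime_q primes_dvd_imp_eq by blast
  then show ?thesis by blast
qed

end

text \<open>For large \<open>i\<close> the prime \<open>q i\<close> divides return times on the
  first side; the isomorphism transports this to the second side, where an odd prime with the
  property lies in the range of \<open>q'\<close>.\<close>

lemma return_equivalent_imp_almost_range:
  assumes "prime_tower q" "prime_tower q'" "\<And>i. q i \<noteq> 2"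
    and "return_equivalent (tower_space q) heisenberg_group (heis_act q)
      (tower_space q') heisenberg_group (heis_act q')"
  obtains N where "\<And>i. i \<ge> N \<Longrightarrow> q i \<in> range q'"
proof -
  interpret A: prime_tower q by fact
  interpret B: prime_tower q' by fact
  obtain U V where U: "adapted (tower_space q) heisenberg_group (heis_act q) U"
    and V: "adapted (tower_space q') heisenberg_group (heis_act q') V"
    and iso: "isomorphic_actions
          (subtopology (tower_space q) U) (holonomy_group heisenberg_group (heis_act q) U) (\<lambda>f. f)
          (subtopology (tower_space q') V) (holonomy_group heisenberg_group (heis_act q') V) (\<lambda>f. f)"
    using assms(4) unfolding return_equivalent_def by blast
  have top: "topspace (subtopology (tower_space q') V) = V"
    using V openin_subset by (force simp: adapted_def)
  have closed: "\<forall>g \<in> carrier (holonomy_group heisenberg_group (heis_act q') V).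
      \<forall>y \<in> topspace (subtopology (tower_space q') V). g y \<in> topspace (subtopology (tower_space q') V)"
    unfolding top using B.holonomy_group_closed[OF V] by blast
  obtain N where N: "\<And>i. i \<ge> N \<Longrightarrow> divides_return_times (subtopology (tower_space q) U)
      (carrier (holonomy_group heisenberg_group (heis_act q) U)) (q i)"
    using A.divides_return_times_tower[OF U] by blast
  have "q i \<in> range q'" if "i \<ge> N" for i
  proof (rule B.divides_return_times_imp_range[OF V _ A.prime_q assms(3)])
    show "divides_return_times (subtopology (tower_space q') V)
        (carrier (holonomy_group heisenberg_group (heis_act q') V)) (q i)"
      by (rule divides_return_times_isomorphic[OF iso closed N[OF that]])
  qed
  then show thesis using that by blast
qed

section \<open>An almost disjoint family of sets of primes\<close>

text \<open>These are codes of the nodes along the branch of the binary tree given by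
  \<open>S\<close>. The marker \<open>i\<close>, larger than all other elements, records the depth.
  Different branches share only finitely many nodes, whence almost disjoint sets of primes.\<close>

definition branch :: "nat set \<Rightarrow> nat \<Rightarrow> nat" where
  "branch S i = set_encode (insert i (S \<inter> {..<i}))"

text \<open>The depth is the largest element of the encoded set; deleting it leaves the initial
  segment.\<close>

lemma branch_eqD:
  assumes "branch S i = branch S' j"
  shows "i = j" "S \<inter> {..<i} = S' \<inter> {..<i}"
proof -
  have eq: "insert i (S \<inter> {..<i}) = insert j (S' \<inter> {..<j})"
    by (rule inj_onD[OF inj_on_set_encode assms[unfolded branch_def]]) simp_all
  then have "i \<in> insert j (S' \<inter> {..<j})" "j \<in> insert i (S \<inter> {..<i})" by blast+
  then have "i \<le> j" "j \<le> i" by auto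
  then show "i = j" by simp
  with eq show "S \<inter> {..<i} = S' \<inter> {..<i}"
    by (metis Diff_insert_absorb IntD2 lessThan_iff less_irrefl)
qed

lemma uncountable_UNIV_nat_set: "uncountable (UNIV :: nat set set)"
proof
  assume "countable (UNIV :: nat set set)"
  then obtain f :: "nat \<Rightarrow> nat set" where "range f = UNIV"
    by (metis UNIV_not_empty range_from_nat_into)
  then show False using Cantors_theorem[of "UNIV :: nat set"] by auto
qed

theorem theorem1p14:
  shows "\<exists>\<C> :: ((nat \<Rightarrow> nat) topology \<times> (int ^ 3 ^ 3 \<Rightarrow> (nat \<Rightarrow> nat) \<Rightarrow> (nat \<Rightarrow> nat))) set.
    uncountable \<C> \<and>
    (\<forall>(X, \<phi>) \<in> \<C>.
       cantor_action X heisenberg_group \<phi> \<and>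
       equicontinuous_action X heisenberg_group \<phi> \<and>
       topologically_free X heisenberg_group \<phi> \<and>
       wild_action X heisenberg_group \<phi>) \<and>
    (\<forall>(X, \<phi>) \<in> \<C>. \<forall>(Y, \<psi>) \<in> \<C>. (X, \<phi>) \<noteq> (Y, \<psi>) \<longrightarrow>
       \<not> return_equivalent X heisenberg_group \<phi> Y heisenberg_group \<psi>)"
proof -
  \<comment> \<open>The prime \<open>2\<close> is left out because the invariant controls odd primes
    only.\<close>
  have "infinite ({p :: nat. prime p} - {2})"
    using primes_infinite by simp
  then obtain pr :: "nat \<Rightarrow> nat" where inj: "inj pr" and pr: "range pr \<subseteq> {p. prime p} - {2}"
    using infinite_countable_subset by blast
  define q where "q S i = pr (branch S i)" for S i
  have tower: "prime_tower (q S)" for S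
  proof
    show "prime (q S i)" for i using pr by (auto simp: q_def)
    show "inj (q S)"
      by (rule injI) (use inj branch_eqD(1) in \<open>auto simp: q_def dest: injD\<close>)
  qed
  have ne2: "q S i \<noteq> 2" for S i using pr by (auto simp: q_def)
  have not_re: "\<not> return_equivalent (tower_space (q S)) heisenberg_group (heis_act (q S))
      (tower_space (q S')) heisenberg_group (heis_act (q S'))" if neq: "S \<noteq> S'" for S S'
  proof
    assume "return_equivalent (tower_space (q S)) heisenberg_group (heis_act (q S))
      (tower_space (q S')) heisenberg_group (heis_act (q S'))"
    then obtain N where N: "\<And>i. i \<ge> N \<Longrightarrow> q S i \<in> range (q S')"
      using return_equivalent_imp_almost_range[OF tower tower ne2] by blast
    obtain k where k: "(k \<in> S) \<noteq> (k \<in> S')" using neq by blast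
    \<comment> \<open>The index is at least \<open>N\<close>, so the prime recurs in the other
      range, and exceeds \<open>k\<close>, so the encoded segments reveal that the sets differ at
      \<open>k\<close>.\<close>
    obtain j where "q S (max N (Suc k)) = q S' j" using N[of "max N (Suc k)"] by auto
    then have "branch S (max N (Suc k)) = branch S' j" using inj by (simp add: q_def inj_eq)
    then have "S \<inter> {..<max N (Suc k)} = S' \<inter> {..<max N (Suc k)}" by (rule branch_eqD(2))
    moreover have "k < max N (Suc k)" by simp
    ultimately show False using k by (metis IntD1 IntI lessThan_iff)
  qed
  define F where "F S = (tower_space (q S), heis_act (q S))" for S
  have "inj F"
  proof (rule injI)
    fix S S' assume "F S = F S'"
    then have eq: "tower_space (q S) = tower_space (q S')" by (simp add: F_def)
    \<comment> \<open>Already the underlying spaces differ for different sets, since they determine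
      the primes.\<close>
    have "q S = q S'"
      by (intro ext antisym tower_space_le) (simp_all add: eq prime_tower.q_pos[OF tower])
    then have "branch S i = branch S' i" for i
      using inj by (metis q_def injD)
    then have "S \<inter> {..<Suc k} = S' \<inter> {..<Suc k}" for k by (rule branch_eqD(2))
    then show "S = S'" by (metis IntD1 IntI lessI lessThan_iff subsetI subset_antisym)
  qed
  then have "uncountable (range F)"
    using uncountable_UNIV_nat_set countable_image_inj_on by blast
  moreover have "\<forall>(X, \<phi>) \<in> range F. cantor_action X heisenberg_group \<phi> \<and>
      equicontinuous_action X heisenberg_group \<phi> \<and>
      topologically_free X heisenberg_group \<phi> \<and> wild_action X heisenberg_group \<phi>"
  proof (intro ballI, elim rangeE)
    fix p S assume p: "p = F S"
    interpret prime_tower "q S" by (rule tower)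
    show "case p of (Y, \<phi>) \<Rightarrow> cantor_action Y heisenberg_group \<phi> \<and>
      equicontinuous_action Y heisenberg_group \<phi> \<and>
      topologically_free Y heisenberg_group \<phi> \<and> wild_action Y heisenberg_group \<phi>"
      unfolding p F_def prod.case
      by (intro conjI cantor_action_heis_act equicontinuous_heis_act topologically_free_heis_act
          wild_heis_act)
  qed
  moreover have "\<forall>(X, \<phi>) \<in> range F. \<forall>(Y, \<psi>) \<in> range F. (X, \<phi>) \<noteq> (Y, \<psi>) \<longrightarrow>
      \<not> return_equivalent X heisenberg_group \<phi> Y heisenberg_group \<psi>"
  proof (intro ballI, elim rangeE, hypsubst, unfold F_def prod.case, intro ballI, elim rangeE,
      hypsubst, unfold prod.case, intro impI)
    fix S S'
    assume "(tower_space (q S), heis_act (q S)) \<noteq> (tower_space (q S'), heis_act (q S'))"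
    then show "\<not> return_equivalent (tower_space (q S)) heisenberg_group (heis_act (q S))
        (tower_space (q S')) heisenberg_group (heis_act (q S'))"
      by (intro not_re) blast
  qed
  ultimately show ?thesis by (intro exI[of _ "range F"] conjI)
qed

end
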